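(* Suppose that $G$ is a locally compact, non-compact Polish group. Then there is a nonempty Polish space $X$ for which there is a free topologically mixing continuous action $G \curvearrowright X$.
   Context: For an action $G \curvearrowright X$ and sets $Y, Z \subseteq X$, let $\Delta(Y,Z) = \{g \in G \mid gY \cap Z \neq \emptyset\}$. When $X$ is a topological space and each $g \in G$ acts by a continuous map, the action is topologically mixing if $\Delta(U,V)$ is co-compact (i.e., $G \setminus \Delta(U,V)$ is compact) for all non-empty open sets $U, V \subseteq X$. The action is free if no point of $X$ is fixed by a non-identity element of $G$. The action is continuous if the map $G \times X \to X$, $(g,x) \mapsto g \cdot x$, is continuous. *)

theory Defs
  imports "HOL-Analysis.Analysis" "HOL-Algebra.Group_Action"
begin

definition Polish_topology :: "'a topology \<Rightarrow> bool" where
  "Polish_topology X \<longleftrightarrow> completely_metrizable_space X \<and> separable_space X"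

locale topological_group = group G for G (structure) +
  fixes T :: "'a topology"
  assumes topspace_eq_carrier: "topspace T = carrier G"
    and continuous_map_mult: "continuous_map (prod_topology T T) T (\<lambda>(g, h). g \<otimes> h)"
    and continuous_map_inv: "continuous_map T T (\<lambda>g. inv g)"

definition return_set ::
  "('g, 'r) monoid_scheme \<Rightarrow> ('g \<Rightarrow> 'x \<Rightarrow> 'x) \<Rightarrow> 'x set \<Rightarrow> 'x set \<Rightarrow> 'g set" where
  "return_set G \<phi> Y Z = {g \<in> carrier G. \<phi> g ` Y \<inter> Z \<noteq> {}}"

definition topologically_mixing ::
  "('g, 'r) monoid_scheme \<Rightarrow> 'g topology \<Rightarrow> 'x topology \<Rightarrow> ('g \<Rightarrow> 'x \<Rightarrow> 'x) \<Rightarrow> bool" where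
  "topologically_mixing G T X \<phi> \<longleftrightarrow>
     (\<forall>U V. openin X U \<and> U \<noteq> {} \<and> openin X V \<and> V \<noteq> {} \<longrightarrow>
        compactin T (carrier G - return_set G \<phi> U V))"

definition free_action ::
  "('g, 'r) monoid_scheme \<Rightarrow> 'x set \<Rightarrow> ('g \<Rightarrow> 'x \<Rightarrow> 'x) \<Rightarrow> bool" where
  "free_action G E \<phi> \<longleftrightarrow> (\<forall>g \<in> carrier G. \<forall>x \<in> E. \<phi> g x = x \<longrightarrow> g = \<one>\<^bsub>G\<^esub>)"

definition continuous_action ::
  "'g topology \<Rightarrow> 'x topology \<Rightarrow> ('g \<Rightarrow> 'x \<Rightarrow> 'x) \<Rightarrow> bool" where
  "continuous_action T X \<phi> \<longleftrightarrow> continuous_map (prod_topology T X) X (\<lambda>(g, x). \<phi> g x)"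

text \<open>
  HOL cannot quantify existentially over types, so "there is a Polish space" has to be read over
  topologies on one fixed type. The type \<open>nat \<Rightarrow> real\<close> loses nothing: every Polish topology, on
  whatever type, is homeomorphic to one on a subset of it. The topology is arbitrary and need not
  be related to the product topology.
\<close>

lemma Polish_topology_homeomorphic_nat_real:
  fixes X :: "'a topology"
  assumes "Polish_topology X"
  shows "\<exists>Y :: (nat \<Rightarrow> real) topology. Polish_topology Y \<and> X homeomorphic_space Y"
proof -
  obtain M d where M: "Metric_space M d" and X: "X = Metric_space.mtopology M d"
    using assms unfolding Polish_topology_def completely_metrizable_space_def by auto
  interpret Metric_space M d by (rule M)
  obtain C where C: "countable C" "C \<subseteq> M" "mtopology closure_of C = M"
    using assms X unfolding Polish_topology_def separable_space_def by auto
  define f :: "'a \<Rightarrow> nat \<Rightarrow> real" where "f x = (\<lambda>n. d x (from_nat_into C n))" for x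
  have inj: "inj_on f M"
  proof (rule inj_onI, rule ccontr)
    fix x y assume xy: "x \<in> M" "y \<in> M" "f x = f y" "x \<noteq> y"
    then have "0 < d x y / 2" by simp
    moreover have "x \<in> mtopology closure_of C" using xy(1) C(3) by simp
    ultimately obtain c where c: "c \<in> C" "d x c < d x y / 2"
      unfolding metric_closure_of mem_Collect_eq in_mball by blast
    obtain n where "from_nat_into C n = c"
      using c C(1) from_nat_into_surj by metis
    with xy(3) have "d x c = d y c" unfolding f_def by metis
    moreover have "d x y \<le> d x c + d c y" using xy c C(2) triangle by blast
    ultimately show False using c commute[of c y] by linarith
  qed
  define g where "g = inv_into M f"
  define Y where "Y = pullback_topology (f ` M) g X"
  have tX: "topspace X = M" by (simp add: X)
  have gf: "g (f x) = x" if "x \<in> M" for x using inj that by (simp add: g_def)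
  have tY: "topspace Y = f ` M"
    unfolding Y_def topspace_pullback_topology tX using gf by auto
  have "continuous_map X Y f"
    unfolding continuous_map_def
  proof (intro conjI allI impI)
    show "f \<in> topspace X \<rightarrow> topspace Y" by (auto simp: tX tY)
    fix U assume "openin Y U"
    then obtain W where W: "openin X W" "U = g -` W \<inter> f ` M"
      unfolding Y_def openin_pullback_topology by auto
    then have "{x \<in> topspace X. f x \<in> U} = W"
      using openin_subset[OF W(1)] by (auto simp: tX gf dest: inj_onD[OF inj])
    then show "openin X {x \<in> topspace X. f x \<in> U}" using W by simp
  qed
  moreover have "continuous_map Y X g"
    unfolding Y_def using continuous_map_pullback[of X X id "f ` M" g] by simp
  ultimately have "homeomorphic_maps X Y f g"
    unfolding homeomorphic_maps_def by (auto simp: tX tY gf)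
  then have "X homeomorphic_space Y" by (auto simp: homeomorphic_space_def)
  with assms show ?thesis
    unfolding Polish_topology_def
    using homeomorphic_completely_metrizable_space homeomorphic_separable_space by blast
qed

end

theory Submission
  imports Defs
begin

text \<open>
  The group acts by left translation, \<open>(g \<cdot> f) x = f (g\<^sup>-\<^sup>1 x)\<close>, on the space \<open>C(G)\<close> of continuous
  real functions on \<open>G\<close> with the topology of uniform convergence on compact sets. Since \<open>G\<close> is locally
  compact and second countable, \<open>C(G)\<close> is Polish, and the action is continuous. It is not free: the
  constants, for instance, are fixed. The required space is its free part, the set of functions with
  trivial stabiliser, carried over to a topology on \<open>nat \<Rightarrow> real\<close>.

  Both mixing and the abundance of free points rest on one remark: membership in a basic open set
  constrains a function on a compact set only, and by Urysohn's lemma a continuous function can be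
  prescribed independently on two disjoint compact sets (\<open>glue_on_disjoint_compacts\<close>).

  \<^item> Mixing. Let the values of \<open>f\<close> be constrained on \<open>K\<close> and those of \<open>g \<cdot> f\<close> on \<open>L\<close>. The second
    condition constrains \<open>f\<close> on \<open>g\<^sup>-\<^sup>1 L\<close>, so the two are compatible as soon as \<open>K\<close> and \<open>g\<^sup>-\<^sup>1 L\<close> are
    disjoint, that is, for all \<open>g\<close> outside the compact set \<open>L K\<^sup>-\<^sup>1\<close>.

  \<^item> Free points. For compact \<open>C\<close> not containing the identity, the functions fixed by no element of
    \<open>C\<close> form an open set, by the tube lemma. This set is dense: given a constraint on \<open>K\<close>,
    non-compactness of \<open>G\<close> provides a point \<open>p\<close> such that \<open>p\<close> and \<open>C\<^sup>-\<^sup>1 p\<close> avoid \<open>K\<close>, and a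
    function that is 1 at \<open>p\<close> and 0 on \<open>C\<^sup>-\<^sup>1 p\<close> is fixed by no element of \<open>C\<close>. As \<open>G\<close> minus the
    identity is a countable union of compact sets, the Baire category theorem makes the free part a
    dense \<open>G\<^sub>\<delta>\<close> set (\<open>dense_free_maps\<close>, \<open>Polish_free_maps\<close>).

  The free part is invariant, and by density every return set between open sets of \<open>C(G)\<close> is already
  witnessed by a free point; so mixing passes to the free part (\<open>mixing_free_maps\<close>).
\<close>

section \<open>The compact-open topology on real functions\<close>

lemma metrizable_separable_imp_second_countable:
  assumes "metrizable_space X" and "separable_space X"
  shows "second_countable X"
proof -
  obtain M d where M: "Metric_space M d" and X: "X = Metric_space.mtopology M d"
    using assms(1) unfolding metrizable_space_def by auto
  interpret Metric_space M d by (rule M)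
  obtain C where C: "countable C" "C \<subseteq> M" "mtopology closure_of C = M"
    using assms X unfolding separable_space_def by auto
  define \<B> where "\<B> = (\<lambda>(c, n). mball c (inverse (real (Suc n)))) ` (C \<times> UNIV)"
  have "countable \<B>" using C by (simp add: \<B>_def)
  moreover have "openin X V" if "V \<in> \<B>" for V
    using that X by (auto simp: \<B>_def)
  moreover have "\<exists>V\<in>\<B>. x \<in> V \<and> V \<subseteq> U" if "openin X U" "x \<in> U" for U x
  proof -
    obtain r where r: "r > 0" "mball x r \<subseteq> U" and xM: "x \<in> M"
      using \<open>openin X U\<close> \<open>x \<in> U\<close> unfolding X openin_mtopology by blast
    obtain n where n: "inverse (real (Suc n)) < r / 2"
      using reals_Archimedean[of "r/2"] r by auto
    have "x \<in> mtopology closure_of C" using C xM by simp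
    moreover have "0 < inverse (real (Suc n))" by simp
    ultimately obtain c where c: "c \<in> C" "c \<in> mball x (inverse (real (Suc n)))"
      unfolding metric_closure_of by blast
    have "mball c (inverse (real (Suc n))) \<subseteq> mball x r"
    proof
      fix y assume "y \<in> mball c (inverse (real (Suc n)))"
      then show "y \<in> mball x r"
        using triangle[of x c y] c n by auto
    qed
    moreover have "x \<in> mball c (inverse (real (Suc n)))"
      using c by (auto simp: commute)
    ultimately show ?thesis
      using c(1) r(2) unfolding \<B>_def by blast
  qed
  ultimately show ?thesis unfolding second_countable_def by blast
qed

text \<open>
  Restricting to extensional functions makes two functions equal as soon as they agree on the
  underlying space, so that the metric below separates points.
\<close>
definition cmaps :: "'a topology \<Rightarrow> ('a \<Rightarrow> real) set" where
  "cmaps T = {f \<in> extensional (topspace T). continuous_map T euclideanreal f}"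

definition near :: "'a topology \<Rightarrow> ('a \<Rightarrow> real) \<Rightarrow> 'a set \<Rightarrow> real \<Rightarrow> ('a \<Rightarrow> real) set" where
  "near T f K e = {h \<in> cmaps T. \<forall>x\<in>K. \<bar>f x - h x\<bar> < e}"

text \<open>
  Uniform convergence on compact sets, which for maps into the reals is the compact-open topology.
  The sets \<open>near T f K e\<close> serve as neighbourhoods of \<open>f\<close>; in this form the dynamical arguments can work
  with compact sets of group elements directly, without a metric on functions.
\<close>
definition compact_open :: "'a topology \<Rightarrow> ('a \<Rightarrow> real) topology" where
  "compact_open T = topology (\<lambda>U. U \<subseteq> cmaps T \<and>
     (\<forall>f\<in>U. \<exists>K e. compactin T K \<and> 0 < e \<and> near T f K e \<subseteq> U))"

lemma openin_compact_open:
  "openin (compact_open T) U \<longleftrightarrow> U \<subseteq> cmaps T \<and>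
     (\<forall>f\<in>U. \<exists>K e. compactin T K \<and> 0 < e \<and> near T f K e \<subseteq> U)"
proof -
  let ?L = "\<lambda>U. U \<subseteq> cmaps T \<and> (\<forall>f\<in>U. \<exists>K e. compactin T K \<and> 0 < e \<and> near T f K e \<subseteq> U)"
  have "?L (S \<inter> U)" if S: "?L S" and U: "?L U" for S U
  proof (intro conjI ballI)
    fix f assume f: "f \<in> S \<inter> U"
    obtain K1 e1 where 1: "compactin T K1" "0 < e1" "near T f K1 e1 \<subseteq> S" using S f by blast
    obtain K2 e2 where 2: "compactin T K2" "0 < e2" "near T f K2 e2 \<subseteq> U" using U f by blast
    have "near T f (K1 \<union> K2) (min e1 e2) \<subseteq> S \<inter> U"
      using 1(3) 2(3) by (auto simp: near_def subset_iff)
    then show "\<exists>K e. compactin T K \<and> 0 < e \<and> near T f K e \<subseteq> S \<inter> U"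
      using 1 2 compactin_Un by (metis min_less_iff_conj)
  qed (use that in blast)
  moreover have "?L (\<Union>\<K>)" if "\<forall>K\<in>\<K>. ?L K" for \<K>
  proof (intro conjI ballI)
    fix f assume "f \<in> \<Union>\<K>"
    then obtain S where S: "S \<in> \<K>" "f \<in> S" by blast
    then obtain K e where "compactin T K" "0 < e" "near T f K e \<subseteq> S" using \<open>\<forall>K\<in>\<K>. ?L K\<close> by blast
    then show "\<exists>K e. compactin T K \<and> 0 < e \<and> near T f K e \<subseteq> \<Union>\<K>" using S by blast
  qed (use that in blast)
  ultimately have "istopology ?L" unfolding istopology_def by blast
  then show ?thesis unfolding compact_open_def by (simp only: topology_inverse')
qed

lemma near_subset: "near T f K e \<subseteq> cmaps T"
  by (auto simp: near_def)

lemma topspace_compact_open [simp]: "topspace (compact_open T) = cmaps T"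
proof (rule antisym)
  show "topspace (compact_open T) \<subseteq> cmaps T"
    using openin_topspace[of "compact_open T"] unfolding openin_compact_open by blast
  have "openin (compact_open T) (cmaps T)"
    unfolding openin_compact_open using near_subset compactin_empty zero_less_one by blast
  then show "cmaps T \<subseteq> topspace (compact_open T)" by (rule openin_subset)
qed

text \<open>
  A function that is within \<open>e\<close> of \<open>f\<close> on a compact \<open>K\<close> is within some \<open>c < e\<close> of it, and such
  uniform bounds survive small perturbations on \<open>K\<close>.
\<close>
lemma open_subset_near:
  assumes "f \<in> cmaps T" "compactin T K" "0 < e"
  obtains U where "openin (compact_open T) U" "f \<in> U" "U \<subseteq> near T f K e"
proof -
  define U where "U = {h \<in> cmaps T. \<exists>c<e. \<forall>x\<in>K. \<bar>f x - h x\<bar> \<le> c}"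
  have "\<exists>C r. compactin T C \<and> 0 < r \<and> near T h C r \<subseteq> U" if "h \<in> U" for h
  proof -
    obtain c where c: "c < e" "\<And>x. x \<in> K \<Longrightarrow> \<bar>f x - h x\<bar> \<le> c"
      using \<open>h \<in> U\<close> unfolding U_def by blast
    have "near T h K ((e - c) / 2) \<subseteq> U"
    proof
      fix k assume k: "k \<in> near T h K ((e - c) / 2)"
      have "\<bar>f x - k x\<bar> \<le> (e + c) / 2" if "x \<in> K" for x
      proof -
        have "\<bar>h x - k x\<bar> < (e - c) / 2" using k that by (simp add: near_def)
        moreover have "\<bar>f x - k x\<bar> \<le> \<bar>f x - h x\<bar> + \<bar>h x - k x\<bar>"
          using abs_triangle_ineq[of "f x - h x" "h x - k x"] by simp
        ultimately show ?thesis using c(2)[OF that] by (simp add: field_simps)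
      qed
      then show "k \<in> U"
        using k c(1) unfolding U_def near_def by (auto intro!: exI[of _ "(e + c) / 2"])
    qed
    then show ?thesis using assms(2) c(1) by (intro exI[of _ K] exI[of _ "(e - c) / 2"]) auto
  qed
  then have "openin (compact_open T) U"
    unfolding openin_compact_open by (auto simp: U_def)
  moreover have "f \<in> U" using assms by (auto simp: U_def)
  moreover have "U \<subseteq> near T f K e" by (force simp: U_def near_def)
  ultimately show thesis by (rule that)
qed

lemma cmaps_restrict: "continuous_map T euclideanreal f \<Longrightarrow> restrict f (topspace T) \<in> cmaps T"
  by (auto simp: cmaps_def intro: continuous_map_eq)

section \<open>Locally compact, second countable Hausdorff spaces\<close>

locale lc_second_countable =
  fixes T :: "'a topology"
  assumes locally_compact: "locally_compact_space T"
    and Hausdorff: "Hausdorff_space T"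
    and second_countable: "second_countable T"
begin

lemma normal: "normal_space T"
  using locally_compact Hausdorff second_countable
  by (simp add: regular_Lindelof_imp_normal_space locally_compact_Hausdorff_imp_regular_space
      second_countable_imp_Lindelof_space)

lemma compact_imp_closed: "compactin T K \<Longrightarrow> closedin T K"
  using Hausdorff compactin_imp_closedin by blast

lemma compact_neighbourhood:
  assumes "openin T U" "x \<in> U"
  obtains V K where "openin T V" "compactin T K" "x \<in> V" "V \<subseteq> K" "K \<subseteq> U"
  using assms locally_compact locally_compact_space_neighbourhood_base Hausdorff
  unfolding neighbourhood_base_of by meson

text \<open>
  The members of a countable basis that lie in some compact subset of \<open>U\<close> still cover \<open>U\<close>, by local
  compactness. For \<open>U\<close> the whole space this gives an exhaustion; for the complement of a point it
  gives the countably many compact sets to which the category argument is applied.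
\<close>
lemma open_eq_countable_Union:
  assumes "openin T U"
  obtains b K :: "nat \<Rightarrow> 'a set"
    where "\<And>n. openin T (b n)" "\<And>n. compactin T (K n)" "\<And>n. b n \<subseteq> K n" "U = \<Union>(range b)" "U = \<Union>(range K)"
proof -
  obtain \<B> where \<B>: "countable \<B>" "\<And>V. V \<in> \<B> \<Longrightarrow> openin T V"
    and base: "\<And>W x. openin T W \<Longrightarrow> x \<in> W \<Longrightarrow> \<exists>V\<in>\<B>. x \<in> V \<and> V \<subseteq> W"
    using second_countable unfolding second_countable_def by metis
  \<comment> \<open>The empty set is added only so that \<open>\<D>\<close> can be enumerated even if \<open>U\<close> is empty.\<close>
  define \<D> where "\<D> = insert {} {V \<in> \<B>. \<exists>K. compactin T K \<and> V \<subseteq> K \<and> K \<subseteq> U}"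
  have cD: "countable \<D>" "\<D> \<noteq> {}" using \<B> by (auto simp: \<D>_def)
  define b where "b = from_nat_into \<D>"
  have rb: "range b = \<D>" using cD by (simp add: b_def range_from_nat_into)
  then have bD: "b n \<in> \<D>" for n by blast
  then have "\<exists>K. compactin T K \<and> b n \<subseteq> K \<and> K \<subseteq> U" for n
    using compactin_empty unfolding \<D>_def by blast
  then obtain K where K: "\<And>n. compactin T (K n)" "\<And>n. b n \<subseteq> K n" "\<And>n. K n \<subseteq> U" by metis
  have "openin T (b n)" for n using bD[of n] \<B>(2) by (auto simp: \<D>_def)
  moreover have "U \<subseteq> \<Union>(range b)"
  proof
    fix x assume "x \<in> U"
    obtain V C where V: "openin T V" "compactin T C" "x \<in> V" "V \<subseteq> C" "C \<subseteq> U"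
      using compact_neighbourhood[OF assms \<open>x \<in> U\<close>] .
    then obtain W where "W \<in> \<B>" "x \<in> W" "W \<subseteq> V" using base by blast
    then have "W \<in> \<D>" using V unfolding \<D>_def by blast
    with \<open>x \<in> W\<close> show "x \<in> \<Union>(range b)" unfolding rb by blast
  qed
  moreover have "\<Union>(range b) \<subseteq> \<Union>(range K)" "\<Union>(range K) \<subseteq> U" using K(2,3) by blast+
  ultimately have "U = \<Union>(range b)" "U = \<Union>(range K)" by (meson order.trans subset_antisym)+
  with \<open>\<And>n. openin T (b n)\<close> K(1,2) show thesis by (rule that)
qed

text \<open>
  A strictly positive function that is bounded away from 0 on compact sets and vanishes at infinity.
  It turns uniform closeness on compact sets into closeness for a single metric.
\<close>
lemma obtain_weight:
  obtains w :: "'a \<Rightarrow> real"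
    where "\<And>x. 0 < w x" "\<And>x. w x \<le> 1"
      and "\<And>K. compactin T K \<Longrightarrow> \<exists>\<delta>>0. \<forall>x\<in>K. \<delta> \<le> w x"
      and "\<And>e. 0 < e \<Longrightarrow> \<exists>K. compactin T K \<and> (\<forall>x\<in>topspace T - K. w x < e)"
proof -
  obtain b K :: "nat \<Rightarrow> 'a set"
    where b: "\<And>n. openin T (b n)" "\<And>n. compactin T (K n)" "\<And>n. b n \<subseteq> K n"
    and cover: "topspace T = \<Union>(range b)" "topspace T = \<Union>(range K)"
    by (rule open_eq_countable_Union[OF openin_topspace]) (rule that)
  define w :: "'a \<Rightarrow> real" where "w x = inverse (real (Suc (LEAST n. x \<in> b n)))" for x
  have "\<exists>\<delta>>0. \<forall>x\<in>C. \<delta> \<le> w x" if C: "compactin T C" for C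
  proof -
    have "C \<subseteq> \<Union>(range b)" using C cover(1) compactin_subset_topspace by blast
    then obtain \<F> where \<F>: "finite \<F>" "\<F> \<subseteq> range b" "C \<subseteq> \<Union>\<F>"
      using compactinD[OF C, of "range b"] b(1) by (metis rangeE)
    then obtain I where I: "finite I" "\<F> = b ` I" by (meson finite_subset_image)
    have "inverse (real (Suc (Max (insert 0 I)))) \<le> w x" if x: "x \<in> C" for x
    proof -
      obtain i where i: "i \<in> I" "x \<in> b i" using x \<F> I by blast
      then have "(LEAST n. x \<in> b n) \<le> i" by (simp add: Least_le)
      also have "i \<le> Max (insert 0 I)" using i I by simp
      finally show ?thesis unfolding w_def by (simp add: le_imp_inverse_le del: of_nat_Suc)
    qed
    then show ?thesis by (intro exI[of _ "inverse (real (Suc (Max (insert 0 I))))"]) auto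
  qed
  moreover have "\<exists>C. compactin T C \<and> (\<forall>x\<in>topspace T - C. w x < e)" if e: "0 < e" for e
  proof -
    obtain N where N: "inverse (real (Suc N)) < e" using e reals_Archimedean by blast
    have "w x < e" if x: "x \<in> topspace T - \<Union>(K ` {..N})" for x
    proof -
      obtain i where "x \<in> b i" using x cover(1) by blast
      then have "x \<in> b (LEAST n. x \<in> b n)" by (rule LeastI)
      then have "x \<in> K (LEAST n. x \<in> b n)" using b(3) by blast
      then have "\<not> (LEAST n. x \<in> b n) \<le> N" using x by auto
      then have "w x \<le> inverse (real (Suc N))"
        unfolding w_def by (intro le_imp_inverse_le) auto
      then show ?thesis using N by linarith
    qed
    moreover have "compactin T (\<Union>(K ` {..N}))" using b(2) by (intro compactin_Union) auto
    ultimately show ?thesis by blast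
  qed
  ultimately show thesis using that[of w] by (auto simp: w_def inverse_le_1_iff)
qed

section \<open>The space of continuous functions is Polish\<close>

text \<open>
  The metric is \<open>sup\<^sub>x min (w x) \<bar>f x - h x\<bar>\<close> for a weight \<open>w\<close> vanishing at infinity. Truncation by \<open>w\<close>
  makes the supremum finite and insensitive to what happens far away, while \<open>w \<ge> \<delta>\<close> on a compact set
  means that a distance below \<open>\<delta>\<close> is an honest uniform estimate there. The last two properties say
  that this metric and uniform convergence on compact sets define the same uniformity; completeness
  and the identification of the topology use nothing else.
\<close>
lemma obtain_metric:
  assumes nonempty: "topspace T \<noteq> {}"
  obtains d where "Metric_space (cmaps T) d"
    and "\<And>K e. \<lbrakk>compactin T K; 0 < e\<rbrakk> \<Longrightarrow>
           \<exists>\<delta>>0. \<forall>f h. d f h < \<delta> \<longrightarrow> (\<forall>x\<in>K. \<bar>f x - h x\<bar> < e)"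
    and "\<And>r. 0 < r \<Longrightarrow>
           \<exists>K e. compactin T K \<and> 0 < e \<and> (\<forall>f h. (\<forall>x\<in>K. \<bar>f x - h x\<bar> < e) \<longrightarrow> d f h < r)"
proof -
  obtain w :: "'a \<Rightarrow> real" where w: "\<And>x. 0 < w x" "\<And>x. w x \<le> 1"
    and lower: "\<And>K. compactin T K \<Longrightarrow> \<exists>\<delta>>0. \<forall>x\<in>K. \<delta> \<le> w x"
    and vanish: "\<And>e. 0 < e \<Longrightarrow> \<exists>K. compactin T K \<and> (\<forall>x\<in>topspace T - K. w x < e)"
    using obtain_weight by blast
  define d :: "('a \<Rightarrow> real) \<Rightarrow> ('a \<Rightarrow> real) \<Rightarrow> real"
    where "d f h = (SUP x\<in>topspace T. min (w x) \<bar>f x - h x\<bar>)" for f h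
  have bdd: "bdd_above ((\<lambda>x. min (w x) \<bar>f x - h x\<bar>) ` topspace T)" for f h :: "'a \<Rightarrow> real"
    by (rule bdd_aboveI2[where M = 1]) (use w(2) in \<open>simp add: min.coboundedI1\<close>)
  have upper: "min (w x) \<bar>f x - h x\<bar> \<le> d f h" if "x \<in> topspace T" for x f h
    unfolding d_def using that bdd by (intro cSUP_upper)
  have least: "d f h \<le> c" if "\<And>x. x \<in> topspace T \<Longrightarrow> min (w x) \<bar>f x - h x\<bar> \<le> c" for f h c
    unfolding d_def using that nonempty by (intro cSUP_least)
  have nonneg: "0 \<le> d f h" for f h
  proof -
    obtain x where x: "x \<in> topspace T" using nonempty by blast
    have "0 \<le> min (w x) \<bar>f x - h x\<bar>" using w(1)[of x] by simp
    then show ?thesis using upper[OF x, of f h] by linarith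
  qed
  have "Metric_space (cmaps T) d"
  proof
    show "0 \<le> d f h" for f h by (rule nonneg)
    show "d f h = d h f" for f h by (simp add: d_def abs_minus_commute)
    show "d f h = 0 \<longleftrightarrow> f = h" if fh: "f \<in> cmaps T" "h \<in> cmaps T" for f h
    proof
      assume 0: "d f h = 0"
      have "f x = h x" if x: "x \<in> topspace T" for x
        using upper[OF x, of f h] w(1)[of x] 0 by (simp add: min_le_iff_disj)
      then show "f = h" using fh by (auto simp: cmaps_def intro: extensionalityI)
    next
      assume "f = h"
      have "d f f \<le> 0" by (rule least) (use w(1) in \<open>simp add: min_le_iff_disj\<close>)
      then show "d f h = 0" using nonneg[of f h] \<open>f = h\<close> by simp
    qed
    show "d f k \<le> d f h + d h k" for f h k
    proof (rule least)
      fix x assume x: "x \<in> topspace T"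
      have "min (w x) \<bar>f x - k x\<bar> \<le> min (w x) \<bar>f x - h x\<bar> + min (w x) \<bar>h x - k x\<bar>"
        using w(1)[of x] by (auto simp: min_def)
      then show "min (w x) \<bar>f x - k x\<bar> \<le> d f h + d h k"
        using upper[OF x, of f h] upper[OF x, of h k] by linarith
    qed
  qed
  moreover have "\<exists>\<delta>>0. \<forall>f h. d f h < \<delta> \<longrightarrow> (\<forall>x\<in>K. \<bar>f x - h x\<bar> < e)"
    if K: "compactin T K" and e: "0 < e" for K e
  proof -
    obtain \<delta> where \<delta>: "0 < \<delta>" "\<And>x. x \<in> K \<Longrightarrow> \<delta> \<le> w x" using lower[OF K] by blast
    have "\<bar>f x - h x\<bar> < e" if "d f h < min \<delta> e" "x \<in> K" for f h x
    proof -
      have "x \<in> topspace T" using K that(2) compactin_subset_topspace by blast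
      then show ?thesis using upper[of x f h] \<delta>(2)[OF that(2)] that(1) by linarith
    qed
    then show ?thesis using \<delta>(1) e by (intro exI[of _ "min \<delta> e"]) auto
  qed
  moreover have "\<exists>K e. compactin T K \<and> 0 < e \<and> (\<forall>f h. (\<forall>x\<in>K. \<bar>f x - h x\<bar> < e) \<longrightarrow> d f h < r)"
    if r: "0 < r" for r
  proof -
    obtain K where K: "compactin T K" "\<And>x. x \<in> topspace T - K \<Longrightarrow> w x < r / 2"
      using vanish[of "r/2"] r by auto
    have "d f h < r" if "\<forall>x\<in>K. \<bar>f x - h x\<bar> < r / 2" for f h
    proof -
      have "d f h \<le> r / 2"
      proof (rule least)
        fix x assume "x \<in> topspace T"
        then have "\<bar>f x - h x\<bar> < r / 2 \<or> w x < r / 2" using that K(2) by blast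
        then show "min (w x) \<bar>f x - h x\<bar> \<le> r / 2" by linarith
      qed
      then show ?thesis using r by linarith
    qed
    then show ?thesis using K(1) r by (intro exI[of _ K] exI[of _ "r/2"]) auto
  qed
  ultimately show thesis by (rule that)
qed

text \<open>
  A Cauchy sequence is uniformly Cauchy on each compact set, so it converges pointwise and uniformly on
  compact sets; a limit that is uniform on a compact neighbourhood of each point is continuous.
\<close>
lemma completely_metrizable_compact_open:
  assumes nonempty: "topspace T \<noteq> {}"
  shows "completely_metrizable_space (compact_open T)"
proof -
  obtain d where M: "Metric_space (cmaps T) d"
    and unif: "\<And>K e. \<lbrakk>compactin T K; 0 < e\<rbrakk> \<Longrightarrow>
           \<exists>\<delta>>0. \<forall>f h. d f h < \<delta> \<longrightarrow> (\<forall>x\<in>K. \<bar>f x - h x\<bar> < e)"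
    and small: "\<And>r. 0 < r \<Longrightarrow>
           \<exists>K e. compactin T K \<and> 0 < e \<and> (\<forall>f h. (\<forall>x\<in>K. \<bar>f x - h x\<bar> < e) \<longrightarrow> d f h < r)"
    using obtain_metric[OF nonempty] by blast
  interpret Metric_space "cmaps T" d by (rule M)
  have "openin mtopology U \<longleftrightarrow> openin (compact_open T) U" for U
  proof -
    have "(\<exists>r>0. mball f r \<subseteq> U) \<longleftrightarrow> (\<exists>K e. compactin T K \<and> 0 < e \<and> near T f K e \<subseteq> U)"
      if "f \<in> cmaps T" for f
    proof
      assume "\<exists>r>0. mball f r \<subseteq> U"
      then obtain r where r: "r > 0" "mball f r \<subseteq> U" by blast
      obtain K e where "compactin T K" "0 < e" and K: "\<forall>f h. (\<forall>x\<in>K. \<bar>f x - h x\<bar> < e) \<longrightarrow> d f h < r"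
        using small[OF r(1)] by blast
      moreover have "near T f K e \<subseteq> mball f r"
        using K that by (auto simp: near_def)
      ultimately show "\<exists>K e. compactin T K \<and> 0 < e \<and> near T f K e \<subseteq> U" using r(2) by blast
    next
      assume "\<exists>K e. compactin T K \<and> 0 < e \<and> near T f K e \<subseteq> U"
      then obtain K e where K: "compactin T K" "0 < e" "near T f K e \<subseteq> U" by blast
      obtain \<delta> where "\<delta> > 0" and \<delta>: "\<forall>f h. d f h < \<delta> \<longrightarrow> (\<forall>x\<in>K. \<bar>f x - h x\<bar> < e)"
        using unif[OF K(1,2)] by blast
      moreover have "mball f \<delta> \<subseteq> near T f K e"
        using \<delta> by (auto simp: near_def)
      ultimately show "\<exists>r>0. mball f r \<subseteq> U" using K(3) by blast
    qed
    then show ?thesis unfolding openin_mtopology openin_compact_open by blast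
  qed
  then have top: "compact_open T = mtopology" by (simp add: topology_eq)
  have "mcomplete"
    unfolding mcomplete_def
  proof (intro allI impI)
    fix \<sigma> assume "MCauchy \<sigma>"
    then have \<sigma>: "\<And>n. \<sigma> n \<in> cmaps T"
      and Cauchy: "\<And>e. 0 < e \<Longrightarrow> \<exists>N. \<forall>n n'. N \<le> n \<longrightarrow> N \<le> n' \<longrightarrow> d (\<sigma> n) (\<sigma> n') < e"
      unfolding MCauchy_def by auto
    have unifC: "\<exists>N. \<forall>n\<ge>N. \<forall>n'\<ge>N. \<forall>x\<in>K. \<bar>\<sigma> n x - \<sigma> n' x\<bar> < e"
      if K: "compactin T K" and e: "0 < e" for K e
    proof -
      obtain \<delta> where "\<delta> > 0" "\<forall>f h. d f h < \<delta> \<longrightarrow> (\<forall>x\<in>K. \<bar>f x - h x\<bar> < e)"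
        using unif[OF K e] by blast
      then show ?thesis using Cauchy[of \<delta>] by blast
    qed
    define f where "f = (\<lambda>x\<in>topspace T. lim (\<lambda>n. \<sigma> n x))"
    have lim: "(\<lambda>n. \<sigma> n x) \<longlonglongrightarrow> f x" if x: "x \<in> topspace T" for x
    proof -
      have "Cauchy (\<lambda>n. \<sigma> n x)"
        unfolding Cauchy_def dist_real_def using unifC[of "{x}"] x by simp
      then show ?thesis using x by (simp add: f_def Cauchy_convergent_iff convergent_LIMSEQ_iff)
    qed
    have unif_lim: "\<exists>N. \<forall>n\<ge>N. \<forall>x\<in>K. \<bar>\<sigma> n x - f x\<bar> < e"
      if K: "compactin T K" and e: "0 < e" for K e
    proof -
      obtain N where N: "\<forall>n\<ge>N. \<forall>n'\<ge>N. \<forall>x\<in>K. \<bar>\<sigma> n x - \<sigma> n' x\<bar> < e / 2"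
        using unifC[OF K, of "e/2"] e by auto
      have "\<bar>\<sigma> n x - f x\<bar> < e" if n: "n \<ge> N" and x: "x \<in> K" for n x
      proof -
        have "x \<in> topspace T" using K x compactin_subset_topspace by blast
        then have "(\<lambda>n'. \<bar>\<sigma> n x - \<sigma> n' x\<bar>) \<longlonglongrightarrow> \<bar>\<sigma> n x - f x\<bar>"
          by (intro tendsto_intros lim)
        moreover have "\<forall>n'\<ge>N. \<bar>\<sigma> n x - \<sigma> n' x\<bar> \<le> e / 2"
          using N n x by (meson less_imp_le)
        ultimately have "\<bar>\<sigma> n x - f x\<bar> \<le> e / 2" by (meson LIMSEQ_le_const2)
        then show ?thesis using e by linarith
      qed
      then show ?thesis by blast
    qed
    have "continuous_map T Met_TC.mtopology f"
      unfolding Met_TC.continuous_map_to_metric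
    proof (intro ballI allI impI)
      fix x and e :: real assume x: "x \<in> topspace T" and e: "0 < e"
      obtain V K where V: "openin T V" "compactin T K" "x \<in> V" "V \<subseteq> K"
        using compact_neighbourhood[OF openin_topspace x] by metis
      obtain N where N: "\<forall>n\<ge>N. \<forall>x\<in>K. \<bar>\<sigma> n x - f x\<bar> < e / 3"
        using unif_lim[OF V(2), of "e/3"] e by auto
      have "continuous_map T Met_TC.mtopology (\<sigma> N)" using \<sigma>[of N] by (simp add: cmaps_def)
      then have *: "\<forall>r>0. \<exists>U. openin T U \<and> x \<in> U \<and> (\<forall>y\<in>U. \<sigma> N y \<in> Met_TC.mball (\<sigma> N x) r)"
        unfolding Met_TC.continuous_map_to_metric using x by (rule bspec)
      have "\<exists>U. openin T U \<and> x \<in> U \<and> (\<forall>y\<in>U. \<sigma> N y \<in> Met_TC.mball (\<sigma> N x) (e / 3))"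
        by (rule *[rule_format]) (use e in simp)
      then obtain U where U: "openin T U" "x \<in> U" "\<forall>y\<in>U. \<bar>\<sigma> N x - \<sigma> N y\<bar> < e / 3"
        by (auto simp: dist_real_def)
      have "\<bar>f x - f y\<bar> < e" if y: "y \<in> U \<inter> V" for y
      proof -
        have "\<bar>\<sigma> N x - f x\<bar> < e / 3" "\<bar>\<sigma> N y - f y\<bar> < e / 3" "\<bar>\<sigma> N x - \<sigma> N y\<bar> < e / 3"
          using N V U y by auto
        then show ?thesis by linarith
      qed
      then show "\<exists>U. openin T U \<and> x \<in> U \<and> (\<forall>y\<in>U. f y \<in> Met_TC.mball (f x) e)"
        using U V by (intro exI[of _ "U \<inter> V"]) (auto simp: dist_real_def)
    qed
    then have f: "f \<in> cmaps T" by (simp add: cmaps_def f_def)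
    have "\<exists>N. \<forall>n\<ge>N. \<sigma> n \<in> cmaps T \<and> d (\<sigma> n) f < r" if r: "0 < r" for r
    proof -
      obtain K e where K: "compactin T K" "0 < e" "\<forall>f h. (\<forall>x\<in>K. \<bar>f x - h x\<bar> < e) \<longrightarrow> d f h < r"
        using small[OF r] by blast
      then show ?thesis using unif_lim[OF K(1,2)] \<sigma> by blast
    qed
    then show "\<exists>f. limitin mtopology \<sigma> f sequentially"
      using f unfolding limit_metric_sequentially by blast
  qed
  then show ?thesis
    unfolding completely_metrizable_space_def top using M by blast
qed

text \<open>
  Record, for a tolerance \<open>1 / (m + 1)\<close>, a finite set of pairs \<open>(V, q)\<close> of a basic open set and a
  rational such that \<open>f\<close> is within the tolerance of \<open>q\<close> on \<open>V\<close>. There are only countably many such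
  records, and two functions with the same record differ by less than \<open>2 / (m + 1)\<close> on the union
  of the sets \<open>V\<close>. By compactness every \<open>f\<close> and \<open>K\<close> admit a record whose sets cover \<open>K\<close>, so one chosen
  function for each record gives a dense set.
\<close>
lemma separable_compact_open: "separable_space (compact_open T)"
proof -
  obtain \<B> where \<B>: "countable \<B>" "\<And>V. V \<in> \<B> \<Longrightarrow> openin T V"
    and base: "\<And>W x. openin T W \<Longrightarrow> x \<in> W \<Longrightarrow> \<exists>V\<in>\<B>. x \<in> V \<and> V \<subseteq> W"
    using second_countable unfolding second_countable_def by metis
  define fits :: "('a \<Rightarrow> real) \<Rightarrow> ('a set \<times> rat) set \<Rightarrow> nat \<Rightarrow> bool"
    where "fits f F m \<longleftrightarrow> f \<in> cmaps T \<and>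
             (\<forall>(V, q)\<in>F. \<forall>x\<in>V. \<bar>f x - of_rat q\<bar> < inverse (real (Suc m)))" for f F m
  define I where "I = {F. finite F \<and> F \<subseteq> \<B> \<times> (UNIV :: rat set)} \<times> (UNIV :: nat set)"
  define S where "S = (\<lambda>(F, m). SOME f. fits f F m) ` {(F, m) \<in> I. \<exists>f. fits f F m}"
  have "countable I"
    unfolding I_def using \<B>(1) by (intro countable_SIGMA countable_Collect_finite_subset) auto
  then have "countable {(F, m) \<in> I. \<exists>f. fits f F m}"
    by (rule countable_subset[rotated]) auto
  then have "countable S" unfolding S_def by (rule countable_image)
  moreover have "S \<subseteq> cmaps T"
  proof
    fix h assume "h \<in> S"
    then obtain F m where "h = (SOME f. fits f F m)" "\<exists>f. fits f F m" unfolding S_def by auto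
    then have "fits h F m" using someI_ex[of "\<lambda>f. fits f F m"] by simp
    then show "h \<in> cmaps T" by (simp add: fits_def)
  qed
  moreover have "\<exists>h\<in>S. h \<in> U" if U: "openin (compact_open T) U" "f \<in> U" for f U
  proof -
    obtain K e where K: "compactin T K" "0 < e" "near T f K e \<subseteq> U" and f: "f \<in> cmaps T"
      using U unfolding openin_compact_open by blast
    obtain m where m: "inverse (real (Suc m)) < e / 2" using K(2) reals_Archimedean[of "e/2"] by auto
    define P where "P = {(V, q). V \<in> \<B> \<and> (\<forall>x\<in>V. \<bar>f x - of_rat q\<bar> < inverse (real (Suc m)))}"
    have "\<exists>V q. (V, q) \<in> P \<and> x \<in> V" if x: "x \<in> K" for x
    proof -
      have xT: "x \<in> topspace T" using x K(1) compactin_subset_topspace by blast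
      obtain q :: rat where q: "f x - inverse (real (Suc m)) < of_rat q" "of_rat q < f x"
        using of_rat_dense[of "f x - inverse (real (Suc m))" "f x"] by auto
      let ?W = "{y \<in> topspace T. f y \<in> ball (of_rat q) (inverse (real (Suc m)))}"
      have "openin T ?W"
        using f by (intro openin_continuous_map_preimage[of T euclideanreal f]) (auto simp: cmaps_def)
      moreover have "x \<in> ?W" using xT q by (auto simp: dist_real_def)
      ultimately obtain V where V: "V \<in> \<B>" "x \<in> V" "V \<subseteq> ?W" using base by blast
      then have "(V, q) \<in> P" unfolding P_def by (auto simp: dist_real_def abs_minus_commute)
      then show ?thesis using V(2) by blast
    qed
    then have "K \<subseteq> \<Union>(fst ` P)" by force
    then obtain \<F> where \<F>: "finite \<F>" "\<F> \<subseteq> fst ` P" "K \<subseteq> \<Union>\<F>"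
      using compactinD[OF K(1), of "fst ` P"] \<B>(2) unfolding P_def by fastforce
    then obtain F where F: "F \<subseteq> P" "finite F" "\<F> = fst ` F" by (meson finite_subset_image)
    have fit: "fits f F m" using f F(1) by (auto simp: fits_def P_def)
    define h where "h = (SOME f. fits f F m)"
    have "(F, m) \<in> I" using F unfolding I_def P_def by auto
    then have "h \<in> S" unfolding S_def h_def using fit by (auto intro!: image_eqI[of _ _ "(F, m)"])
    moreover have h: "fits h F m" unfolding h_def using someI[of "\<lambda>f. fits f F m", OF fit] .
    have "\<bar>f x - h x\<bar> < e" if x: "x \<in> K" for x
    proof -
      obtain V q where Vq: "(V, q) \<in> F" "x \<in> V" using x \<F>(3) F(3) by auto
      have "\<bar>f x - of_rat q\<bar> < inverse (real (Suc m))" "\<bar>h x - of_rat q\<bar> < inverse (real (Suc m))"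
        using fit h Vq unfolding fits_def by blast+
      then show ?thesis using m by linarith
    qed
    then have "h \<in> U" using K(3) h by (auto simp: near_def fits_def)
    ultimately show ?thesis by blast
  qed
  ultimately show ?thesis
    unfolding separable_space_def
    by (intro exI[of _ S]) (auto simp: in_closure_of Bex_def)
qed

lemma second_countable_compact_open:
  assumes "topspace T \<noteq> {}"
  shows "second_countable (compact_open T)"
  using metrizable_separable_imp_second_countable separable_compact_open
    completely_metrizable_imp_metrizable_space completely_metrizable_compact_open[OF assms] by blast

section \<open>Prescribing values on disjoint compact sets\<close>

text \<open>
  With a Urysohn function \<open>u\<close> that is 0 on \<open>K\<close> and 1 on \<open>L\<close>, the interpolation \<open>(1 - u) f + u h\<close>
  works.
\<close>
lemma glue_on_disjoint_compacts:
  assumes f: "f \<in> cmaps T" and h: "h \<in> cmaps T"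
    and K: "compactin T K" and L: "compactin T L" and "K \<inter> L = {}"
  obtains k where "k \<in> cmaps T" "\<And>x. x \<in> K \<Longrightarrow> k x = f x" "\<And>x. x \<in> L \<Longrightarrow> k x = h x"
proof -
  obtain u where u: "continuous_map T euclideanreal u" "u ` K \<subseteq> {0}" "u ` L \<subseteq> {1}"
    using Urysohn_lemma_alt[OF normal compact_imp_closed[OF K] compact_imp_closed[OF L]] \<open>K \<inter> L = {}\<close>
    unfolding disjnt_def by metis
  define k where "k = (\<lambda>x\<in>topspace T. (1 - u x) * f x + u x * h x)"
  have "k \<in> cmaps T"
    unfolding k_def using f h u(1)
    by (intro cmaps_restrict continuous_intros) (auto simp: cmaps_def)
  moreover have "k x = f x" if "x \<in> K" for x
    using that u(2) compactin_subset_topspace[OF K] by (auto simp: k_def image_subset_iff)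
  moreover have "k x = h x" if "x \<in> L" for x
    using that u(3) compactin_subset_topspace[OF L] by (auto simp: k_def image_subset_iff)
  ultimately show thesis by (rule that)
qed

end

section \<open>The translation action\<close>

locale lcsc_group = topological_group G T + lc_second_countable T
  for G (structure) and T
begin

lemma topspace_nonempty: "topspace T \<noteq> {}"
  using topspace_eq_carrier one_closed by blast

lemma continuous_map_inv_mult:
  "continuous_map (prod_topology T T) T (\<lambda>(g, x). inv g \<otimes> x)"
proof -
  have "continuous_map (prod_topology T T) (prod_topology T T) (\<lambda>p. (inv (fst p), snd p))"
    using continuous_map_compose[OF continuous_map_fst continuous_map_inv]
    by (auto simp: continuous_map_pairwise o_def intro: continuous_map_snd)
  from continuous_map_compose[OF this continuous_map_mult] show ?thesis
    by (simp add: o_def case_prod_unfold)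
qed

lemma continuous_map_inv_mult_left: "g \<in> carrier G \<Longrightarrow> continuous_map T T (\<lambda>x. inv g \<otimes> x)"
  using continuous_map_compose[OF _ continuous_map_inv_mult, of T "\<lambda>x. (g, x)"]
  by (simp add: o_def continuous_map_pairwise topspace_eq_carrier)

lemma compact_inv_mult:
  assumes "compactin T C" "compactin T K"
  shows "compactin T ((\<lambda>(g, x). inv g \<otimes> x) ` (C \<times> K))"
  by (rule image_compactin[OF _ continuous_map_inv_mult]) (simp add: compactin_Times assms)

lemma compact_mult:
  assumes "compactin T C" "compactin T K"
  shows "compactin T ((\<lambda>(g, x). g \<otimes> x) ` (C \<times> K))"
  by (rule image_compactin[OF _ continuous_map_mult]) (simp add: compactin_Times assms)

definition translate :: "'a \<Rightarrow> ('a \<Rightarrow> real) \<Rightarrow> 'a \<Rightarrow> real" where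
  "translate g f = (\<lambda>x\<in>carrier G. f (inv g \<otimes> x))"

lemma translate_in_cmaps:
  assumes "g \<in> carrier G" "f \<in> cmaps T"
  shows "translate g f \<in> cmaps T"
  using cmaps_restrict[OF continuous_map_compose[OF continuous_map_inv_mult_left]] assms
  by (simp add: translate_def cmaps_def topspace_eq_carrier o_def)

lemma translate_one: "f \<in> cmaps T \<Longrightarrow> translate \<one> f = f"
  by (rule extensionalityI[of _ "carrier G"]) (auto simp: translate_def cmaps_def topspace_eq_carrier)

lemma translate_mult:
  assumes "g \<in> carrier G" "h \<in> carrier G"
  shows "translate (g \<otimes> h) f = translate g (translate h f)"
  by (rule extensionalityI[of _ "carrier G"]) (use assms in \<open>auto simp: translate_def inv_mult_group m_assoc\<close>)

text \<open>
  To keep \<open>g \<cdot> f\<close> close to \<open>g\<^sub>0 \<cdot> f\<^sub>0\<close> on \<open>K\<close>, compare both with \<open>g \<cdot> f\<^sub>0\<close>. Passing from \<open>g\<^sub>0\<close> to \<open>g\<close> costs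
  little, uniformly on \<open>K\<close>, by the tube lemma. Passing from \<open>f\<^sub>0\<close> to \<open>f\<close> costs little because \<open>g\<close> may be
  confined to a compact neighbourhood \<open>C\<close> of \<open>g\<^sub>0\<close>, so that only the values on the compact set
  \<open>C\<^sup>-\<^sup>1 K\<close> matter.
\<close>
lemma continuous_translate:
  "continuous_map (prod_topology T (compact_open T)) (compact_open T) (\<lambda>(g, f). translate g f)"
  unfolding continuous_map_def
proof (intro conjI allI impI)
  show "(\<lambda>(g, f). translate g f) \<in> topspace (prod_topology T (compact_open T)) \<rightarrow> topspace (compact_open T)"
    using translate_in_cmaps topspace_eq_carrier by auto
  fix U assume U: "openin (compact_open T) U"
  let ?P = "{p \<in> topspace (prod_topology T (compact_open T)). (case p of (g, f) \<Rightarrow> translate g f) \<in> U}"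
  have "\<exists>Q. openin (prod_topology T (compact_open T)) Q \<and> p \<in> Q \<and> Q \<subseteq> ?P" if p: "p \<in> ?P" for p
  proof -
    obtain g0 f0 where p0: "p = (g0, f0)" by (cases p)
    have g0: "g0 \<in> carrier G" "g0 \<in> topspace T" and f0: "f0 \<in> cmaps T" and U0: "translate g0 f0 \<in> U"
      using p topspace_eq_carrier unfolding p0 by auto
    obtain K e where K: "compactin T K" "0 < e" "near T (translate g0 f0) K e \<subseteq> U"
      using U U0 unfolding openin_compact_open by blast
    have KG: "K \<subseteq> carrier G" using compactin_subset_topspace[OF K(1)] topspace_eq_carrier by simp
    have cf0: "continuous_map T euclideanreal f0" using f0 by (simp add: cmaps_def)
    define \<theta> where "\<theta> = (\<lambda>(g, x). \<bar>f0 (inv g0 \<otimes> x) - f0 (inv g \<otimes> x)\<bar>)"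
    have 1: "continuous_map (prod_topology T T) euclideanreal (\<lambda>(g, x). f0 (inv g \<otimes> x))"
      using continuous_map_compose[OF continuous_map_inv_mult cf0] by (simp add: o_def case_prod_unfold)
    have 2: "continuous_map (prod_topology T T) euclideanreal (\<lambda>(g, x). f0 (inv g0 \<otimes> x))"
      using continuous_map_compose[OF continuous_map_compose[OF continuous_map_snd continuous_map_inv_mult_left[OF g0(1)]] cf0]
      by (simp add: o_def case_prod_unfold)
    have "continuous_map (prod_topology T T) euclideanreal \<theta>"
      using continuous_map_real_abs[OF continuous_map_diff[OF 2 1]]
      by (simp add: \<theta>_def case_prod_unfold)
    then have W: "openin (prod_topology T T) {z \<in> topspace (prod_topology T T). \<theta> z \<in> {..<e/2}}" (is "openin _ ?W")
      by (rule openin_continuous_map_preimage) auto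
    have "{g0} \<times> K \<subseteq> ?W" using g0 KG K(2) by (auto simp: \<theta>_def topspace_eq_carrier)
    then obtain A V where A: "openin T A" "g0 \<in> A" "K \<subseteq> V" "A \<times> V \<subseteq> ?W"
      using tube_lemma_right[OF W K(1) g0(2)] by blast
    obtain B C where B: "openin T B" "compactin T C" "g0 \<in> B" "B \<subseteq> C" "C \<subseteq> A"
      using compact_neighbourhood[OF A(1,2)] .
    have BG: "B \<subseteq> carrier G" using openin_subset[OF B(1)] topspace_eq_carrier by simp
    obtain N where N: "openin (compact_open T) N" "f0 \<in> N"
      "N \<subseteq> near T f0 ((\<lambda>(g, x). inv g \<otimes> x) ` (C \<times> K)) (e / 2)"
      using open_subset_near[OF f0 compact_inv_mult[OF B(2) K(1)], of "e/2"] K(2) by auto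
    have "translate g f \<in> U" if g: "g \<in> B" and f: "f \<in> N" for g f
    proof -
      have fc: "f \<in> cmaps T" using f N(3) near_subset by blast
      have "\<bar>translate g0 f0 x - translate g f x\<bar> < e" if x: "x \<in> K" for x
      proof -
        have "(g, x) \<in> ?W" using A(3,4) B(4,5) g x by blast
        then have 3: "\<bar>f0 (inv g0 \<otimes> x) - f0 (inv g \<otimes> x)\<bar> < e / 2" by (simp add: \<theta>_def)
        have "inv g \<otimes> x \<in> (\<lambda>(g, x). inv g \<otimes> x) ` (C \<times> K)" using B(4) g x by force
        then have "\<bar>f0 (inv g \<otimes> x) - f (inv g \<otimes> x)\<bar> < e / 2"
          using f N(3) unfolding near_def by blast
        with 3 have "\<bar>f0 (inv g0 \<otimes> x) - f (inv g \<otimes> x)\<bar> < e" by linarith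
        then show ?thesis using x KG by (auto simp: translate_def)
      qed
      then show ?thesis
        using K(3) translate_in_cmaps[OF _ fc, of g] g BG by (auto simp: near_def)
    qed
    then have "B \<times> N \<subseteq> ?P"
      using openin_subset[OF B(1)] openin_subset[OF N(1)] by auto
    moreover have "openin (prod_topology T (compact_open T)) (B \<times> N)"
      using B(1) N(1) by (simp add: openin_prod_Times_iff)
    moreover have "p \<in> B \<times> N" using B(3) N(2) p0 by simp
    ultimately show ?thesis by blast
  qed
  then show "openin (prod_topology T (compact_open T)) ?P" by (subst openin_subopen) blast
qed

section \<open>Functions with trivial stabiliser\<close>

definition moved :: "'a set \<Rightarrow> ('a \<Rightarrow> real) set" where
  "moved C = {f \<in> cmaps T. \<forall>g\<in>C. translate g f \<noteq> f}"

definition free_maps :: "('a \<Rightarrow> real) set" where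
  "free_maps = {f \<in> cmaps T. \<forall>g\<in>carrier G. translate g f = f \<longrightarrow> g = \<one>}"

text \<open>
  The pairs \<open>(g, f)\<close> with \<open>g \<cdot> f \<noteq> f\<close> form an open set because the space of functions is Hausdorff;
  since \<open>C\<close> is compact, a tube \<open>C \<times> V\<close> around \<open>C \<times> {f}\<close> fits inside it.
\<close>
lemma openin_moved:
  assumes C: "compactin T C"
  shows "openin (compact_open T) (moved C)"
proof -
  let ?X = "prod_topology T (compact_open T)"
  have "Hausdorff_space (compact_open T)"
    using completely_metrizable_compact_open[OF topspace_nonempty] completely_metrizable_imp_metrizable_space
      metrizable_imp_Hausdorff_space by blast
  then have "closedin ?X {p \<in> topspace ?X. (case p of (g, f) \<Rightarrow> translate g f) = snd p}"
    by (intro closedin_continuous_maps_eq[OF _ continuous_translate continuous_map_snd])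
  then have "openin ?X (topspace ?X - {p \<in> topspace ?X. (case p of (g, f) \<Rightarrow> translate g f) = snd p})"
    by (rule openin_diff[OF openin_topspace])
  also have "topspace ?X - {p \<in> topspace ?X. (case p of (g, f) \<Rightarrow> translate g f) = snd p}
    = {(g, f). g \<in> topspace T \<and> f \<in> cmaps T \<and> translate g f \<noteq> f}" (is "_ = ?W")
    by auto
  finally have W: "openin ?X ?W" .
  have "\<exists>U. openin (compact_open T) U \<and> f \<in> U \<and> U \<subseteq> moved C" if f: "f \<in> moved C" for f
  proof -
    have sub: "C \<times> {f} \<subseteq> ?W" using f compactin_subset_topspace[OF C] by (auto simp: moved_def)
    have "f \<in> topspace (compact_open T)" using f by (simp add: moved_def)
    then obtain U V where UV: "openin (compact_open T) V" "C \<subseteq> U" "f \<in> V" "U \<times> V \<subseteq> ?W"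
      using tube_lemma_left[OF W C _ sub] by blast
    then have "V \<subseteq> moved C"
      using openin_subset[OF UV(1)] by (auto simp: moved_def)
    then show ?thesis using UV by blast
  qed
  then show ?thesis by (subst openin_subopen) blast
qed

text \<open>
  One point suffices to defeat all of \<open>C\<close> at once: a function that is 1 at \<open>p\<close> and 0 on \<open>C\<^sup>-\<^sup>1 p\<close> has
  \<open>(g \<cdot> k) p = 0 \<noteq> k p\<close> for every \<open>g \<in> C\<close>. The group being non-compact, \<open>p\<close> can be chosen outside
  \<open>K \<union> C K\<close>, so that this prescription does not interfere with the values on \<open>K\<close>.
\<close>
lemma dense_moved:
  assumes noncompact: "\<not> compact_space T" and C: "compactin T C" and "\<one> \<notin> C"
  shows "compact_open T closure_of moved C = cmaps T"
proof -
  have CG: "C \<subseteq> carrier G" using compactin_subset_topspace[OF C] topspace_eq_carrier by simp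
  have "\<exists>k\<in>moved C. k \<in> U" if U: "openin (compact_open T) U" "f \<in> U" for f U
  proof -
    obtain K e where K: "compactin T K" "0 < e" "near T f K e \<subseteq> U" and f: "f \<in> cmaps T"
      using U unfolding openin_compact_open by blast
    have KG: "K \<subseteq> carrier G" using compactin_subset_topspace[OF K(1)] topspace_eq_carrier by simp
    let ?L = "K \<union> (\<lambda>(g, x). g \<otimes> x) ` (C \<times> K)"
    have "compactin T ?L" by (intro compactin_Un K compact_mult C)
    then have "?L \<noteq> topspace T" using noncompact by (auto simp: compact_space_def)
    then obtain p where p: "p \<in> carrier G" "p \<notin> ?L"
      using compactin_subset_topspace[OF \<open>compactin T ?L\<close>] topspace_eq_carrier by blast
    define D where "D = (\<lambda>(g, x). inv g \<otimes> x) ` (C \<times> {p})"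
    have pc: "compactin T {p}" using p(1) topspace_eq_carrier by simp
    have D: "compactin T D" unfolding D_def by (rule compact_inv_mult[OF C pc])
    have pD: "{p} \<inter> D = {}"
    proof (rule ccontr)
      assume "{p} \<inter> D \<noteq> {}"
      then obtain g where g: "g \<in> C" "p = inv g \<otimes> p" unfolding D_def by auto
      moreover have "g \<in> carrier G" using g(1) CG by blast
      ultimately have "g = \<one>" using p(1) by simp
      then show False using g(1) \<open>\<one> \<notin> C\<close> by blast
    qed
    have KD: "K \<inter> ({p} \<union> D) = {}"
    proof (rule ccontr)
      assume "K \<inter> ({p} \<union> D) \<noteq> {}"
      then obtain g where g: "g \<in> C" "inv g \<otimes> p \<in> K" using p(2) unfolding D_def by auto
      have "g \<otimes> (inv g \<otimes> p) = p"
        using g CG p(1) by (simp add: subset_iff m_assoc[symmetric])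
      then have "p \<in> (\<lambda>(g, x). g \<otimes> x) ` (C \<times> K)" using g by force
      then show False using p(2) by blast
    qed
    define c :: "real \<Rightarrow> 'a \<Rightarrow> real" where "c r = (\<lambda>x\<in>topspace T. r)" for r
    have c: "c r \<in> cmaps T" for r unfolding c_def by (intro cmaps_restrict) simp
    obtain h where h: "h \<in> cmaps T" "\<And>x. x \<in> {p} \<Longrightarrow> h x = c 1 x" "\<And>x. x \<in> D \<Longrightarrow> h x = c 0 x"
      using glue_on_disjoint_compacts[OF c c pc D pD] by blast
    obtain k where k: "k \<in> cmaps T" "\<And>x. x \<in> K \<Longrightarrow> k x = f x" "\<And>x. x \<in> {p} \<union> D \<Longrightarrow> k x = h x"
      using glue_on_disjoint_compacts[OF f h(1) K(1) compactin_Un[OF pc D] KD] by blast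
    have "translate g k \<noteq> k" if g: "g \<in> C" for g
    proof -
      have gp: "inv g \<otimes> p \<in> D" using g unfolding D_def by force
      then have "k (inv g \<otimes> p) = 0"
        using k(3) h(3) compactin_subset_topspace[OF D] by (auto simp: c_def)
      moreover have "k p = 1" using k(3) h(2) p(1) by (simp add: c_def topspace_eq_carrier)
      ultimately have "translate g k p \<noteq> k p" using p(1) by (simp add: translate_def)
      then show ?thesis by metis
    qed
    then have "k \<in> moved C" using k(1) by (simp add: moved_def)
    moreover have "k \<in> U" using K(2,3) k(1,2) by (auto simp: near_def)
    ultimately show ?thesis by blast
  qed
  then show ?thesis by (auto simp: in_closure_of Bex_def)
qed

lemma free_maps_eq_Inter_moved:
  obtains K :: "nat \<Rightarrow> 'a set"
    where "\<And>n. compactin T (K n)" "\<And>n. \<one> \<notin> K n" "free_maps = (\<Inter>n. moved (K n))"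
proof -
  have "openin T (topspace T - {\<one>})"
    using topspace_eq_carrier by (intro openin_diff[OF openin_topspace compact_imp_closed]) simp
  then obtain b K :: "nat \<Rightarrow> 'a set" where K: "\<And>n. compactin T (K n)" "topspace T - {\<one>} = \<Union>(range K)"
    by (rule open_eq_countable_Union) (rule that)
  have "f \<in> free_maps \<longleftrightarrow> (\<forall>n. f \<in> moved (K n))" for f
  proof -
    have "f \<in> free_maps \<longleftrightarrow> f \<in> cmaps T \<and> (\<forall>g\<in>topspace T - {\<one>}. translate g f \<noteq> f)"
      by (auto simp: free_maps_def topspace_eq_carrier)
    then show ?thesis unfolding K(2) moved_def by blast
  qed
  then have "free_maps = (\<Inter>n. moved (K n))" by auto
  moreover have "\<one> \<notin> K n" for n using K(2) by blast
  ultimately show thesis using that K(1) by blast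
qed

text \<open>
  By Baire, as a countable intersection of dense open sets in a completely metrizable space.
\<close>
lemma dense_free_maps:
  assumes noncompact: "\<not> compact_space T"
  shows "compact_open T closure_of free_maps = cmaps T"
proof -
  obtain K :: "nat \<Rightarrow> 'a set" where K: "\<And>n. compactin T (K n)" "\<And>n. \<one> \<notin> K n"
    and free: "free_maps = (\<Inter>n. moved (K n))"
    by (rule free_maps_eq_Inter_moved) (rule that)
  have "compact_open T closure_of \<Inter>(range (\<lambda>n. moved (K n))) = topspace (compact_open T)"
    using completely_metrizable_compact_open[OF topspace_nonempty] openin_moved[OF K(1)]
      dense_moved[OF noncompact K] by (intro Baire_category) auto
  then show ?thesis by (simp add: free)
qed

lemma Polish_free_maps: "Polish_topology (subtopology (compact_open T) free_maps)"
proof -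
  obtain K :: "nat \<Rightarrow> 'a set" where K: "\<And>n. compactin T (K n)"
    and free: "free_maps = (\<Inter>n. moved (K n))"
    by (rule free_maps_eq_Inter_moved) (rule that)
  have "gdelta_in (compact_open T) (\<Inter>(range (\<lambda>n. moved (K n))))"
  proof (rule gdelta_in_Inter)
    show "gdelta_in (compact_open T) S" if "S \<in> range (\<lambda>n. moved (K n))" for S
      using that openin_moved[OF K] open_imp_gdelta_in by blast
  qed auto
  then show ?thesis
    unfolding Polish_topology_def free
    by (simp add: completely_metrizable_space_gdelta_in completely_metrizable_compact_open[OF topspace_nonempty]
        second_countable_imp_separable_space second_countable_subtopology
        second_countable_compact_open[OF topspace_nonempty])
qed

text \<open>
  The stabiliser of \<open>g \<cdot> f\<close> is conjugate to that of \<open>f\<close>.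
\<close>
lemma translate_in_free_maps:
  assumes g: "g \<in> carrier G" and f: "f \<in> free_maps"
  shows "translate g f \<in> free_maps"
proof -
  have fc: "f \<in> cmaps T" using f by (simp add: free_maps_def)
  have "h = \<one>" if h: "h \<in> carrier G" and stab: "translate h (translate g f) = translate g f" for h
  proof -
    have "translate (inv g \<otimes> (h \<otimes> g)) f = translate (inv g) (translate h (translate g f))"
      using g h by (simp add: translate_mult)
    also have "\<dots> = translate (inv g \<otimes> g) f" using stab translate_mult[of "inv g" g f] g by simp
    also have "\<dots> = f" using g fc by (simp add: translate_one)
    finally have "inv g \<otimes> (h \<otimes> g) = \<one>" using f g h by (simp add: free_maps_def)
    then show "h = \<one>" using g h by (simp add: inv_solve_left')
  qed
  then show ?thesis using translate_in_cmaps[OF g fc] by (simp add: free_maps_def)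
qed

section \<open>Mixing on the free part\<close>

lemma continuous_action_free_maps:
  "continuous_action T (subtopology (compact_open T) free_maps) translate"
proof -
  let ?X = "subtopology (compact_open T) free_maps"
  have "prod_topology T ?X = subtopology (prod_topology T (compact_open T)) (topspace T \<times> free_maps)"
    by (simp add: prod_topology_subtopology)
  moreover have "translate g f \<in> free_maps" if "(g, f) \<in> topspace (prod_topology T ?X)" for g f
    using that translate_in_free_maps topspace_eq_carrier by auto
  ultimately show ?thesis
    unfolding continuous_action_def continuous_map_in_subtopology
    using continuous_map_from_subtopology[OF continuous_translate] by (auto simp: image_subset_iff)
qed

text \<open>
  The complement of the return set is closed, because the orbit maps are continuous, so it is enough
  to place it inside a compact set. If \<open>g \<notin> L K\<^sup>-\<^sup>1\<close> then \<open>K\<close> and \<open>g\<^sup>-\<^sup>1 L\<close> are disjoint, and some \<open>k\<close>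
  agrees with \<open>f1\<close> on \<open>K\<close> while \<open>g \<cdot> k\<close> agrees with \<open>f2\<close> on \<open>L\<close>. That \<open>k\<close> need not be free, but the
  conditions on it are open, so by density a free function satisfies them too.
\<close>
lemma mixing_free_maps:
  assumes noncompact: "\<not> compact_space T"
  shows "topologically_mixing G T (subtopology (compact_open T) free_maps) translate"
  unfolding topologically_mixing_def
proof (intro allI impI, elim conjE)
  let ?X = "subtopology (compact_open T) free_maps"
  fix U V assume "openin ?X U" "U \<noteq> {}" "openin ?X V" "V \<noteq> {}"
  then obtain U' V' where U': "openin (compact_open T) U'" "U = U' \<inter> free_maps"
    and V': "openin (compact_open T) V'" "V = V' \<inter> free_maps"
    unfolding openin_subtopology by blast
  obtain f1 f2 where f: "f1 \<in> U'" "f2 \<in> V'"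
    using U' V' \<open>U \<noteq> {}\<close> \<open>V \<noteq> {}\<close> by blast
  obtain K e where K: "compactin T K" "0 < e" "near T f1 K e \<subseteq> U'" and f1: "f1 \<in> cmaps T"
    using U'(1) f(1) unfolding openin_compact_open by blast
  obtain L r where L: "compactin T L" "0 < r" "near T f2 L r \<subseteq> V'" and f2: "f2 \<in> cmaps T"
    using V'(1) f(2) unfolding openin_compact_open by blast
  have KG: "K \<subseteq> carrier G" "L \<subseteq> carrier G"
    using compactin_subset_topspace[OF K(1)] compactin_subset_topspace[OF L(1)] topspace_eq_carrier
    by simp_all
  have orbit_map: "continuous_map T (compact_open T) (\<lambda>g. translate g k)" if "k \<in> cmaps T" for k
    using continuous_map_compose[OF _ continuous_translate, of T "\<lambda>g. (g, k)"] that
    by (simp add: o_def continuous_map_pairwise)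
  let ?R = "return_set G translate U V"
  have "openin T ?R"
  proof -
    have "?R = (\<Union>k\<in>U. {g \<in> topspace T. translate g k \<in> V'})"
      using translate_in_free_maps unfolding return_set_def U'(2) V'(2) topspace_eq_carrier by auto
    moreover have "openin T {g \<in> topspace T. translate g k \<in> V'}" if "k \<in> U" for k
      using that U'(2) by (intro openin_continuous_map_preimage[OF orbit_map V'(1)]) (auto simp: free_maps_def)
    ultimately show ?thesis by auto
  qed
  then have closed: "closedin T (carrier G - ?R)"
    by (simp flip: topspace_eq_carrier add: closedin_diff)
  let ?I = "(\<lambda>x. inv x) ` K"
  have I: "compactin T ?I" by (rule image_compactin[OF K(1) continuous_map_inv])
  have "g \<in> ?R" if g: "g \<in> carrier G" and far: "g \<notin> (\<lambda>(g, x). g \<otimes> x) ` (L \<times> ?I)" for g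
  proof -
    define M where "M = (\<lambda>(g, x). inv g \<otimes> x) ` ({g} \<times> L)"
    have M: "compactin T M"
      unfolding M_def using g topspace_eq_carrier by (intro compact_inv_mult L) auto
    have KM: "K \<inter> M = {}"
    proof (rule ccontr)
      assume "K \<inter> M \<noteq> {}"
      then obtain x where x: "x \<in> L" "inv g \<otimes> x \<in> K" unfolding M_def by auto
      have xG: "x \<in> carrier G" using x KG by blast
      have "x \<otimes> inv (inv g \<otimes> x) = g"
        using g xG by (simp add: inv_mult_group m_assoc[symmetric])
      then have "g \<in> (\<lambda>(g, x). g \<otimes> x) ` (L \<times> ?I)" using x by force
      then show False using far by blast
    qed
    obtain k where k: "k \<in> cmaps T" "\<And>x. x \<in> K \<Longrightarrow> k x = f1 x"
        "\<And>x. x \<in> M \<Longrightarrow> k x = translate (inv g) f2 x"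
      using glue_on_disjoint_compacts[OF f1 translate_in_cmaps[OF _ f2] K(1) M KM, of "inv g"] g by auto
    have "translate g k x = f2 x" if x: "x \<in> L" for x
    proof -
      have xG: "x \<in> carrier G" using x KG by blast
      have "inv g \<otimes> x \<in> M" using x unfolding M_def by force
      then have "translate g k x = translate (inv g) f2 (inv g \<otimes> x)"
        using k(3) xG by (simp add: translate_def)
      also have "\<dots> = f2 x"
        using g xG by (simp add: translate_def m_assoc[symmetric])
      finally show ?thesis .
    qed
    then have "translate g k \<in> V'"
      using L(2,3) translate_in_cmaps[OF g k(1)] by (auto simp: near_def)
    moreover have "k \<in> U'" using K(2,3) k(1,2) by (auto simp: near_def)
    moreover define W where "W = U' \<inter> {k \<in> cmaps T. translate g k \<in> V'}"
    ultimately have "k \<in> W" using k(1) by simp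
    have "continuous_map (compact_open T) (compact_open T) (translate g)"
      using continuous_map_compose[OF _ continuous_translate, of "compact_open T" "\<lambda>k. (g, k)"] g
      by (simp add: o_def continuous_map_pairwise topspace_eq_carrier)
    from openin_continuous_map_preimage[OF this V'(1)] have "openin (compact_open T) W"
      unfolding W_def using U'(1) by (intro openin_Int) auto
    moreover have "k \<in> compact_open T closure_of free_maps"
      using dense_free_maps[OF noncompact] k(1) by simp
    ultimately obtain k' where "k' \<in> free_maps" "k' \<in> W"
      using \<open>k \<in> W\<close> unfolding in_closure_of by blast
    then have "k' \<in> free_maps" "k' \<in> U'" "translate g k' \<in> V'" unfolding W_def by simp_all
    then show ?thesis
      using g translate_in_free_maps[OF g] unfolding return_set_def U'(2) V'(2) by blast
  qed
  then have "carrier G - ?R \<subseteq> (\<lambda>(g, x). g \<otimes> x) ` (L \<times> ?I)" by blast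
  then show "compactin T (carrier G - ?R)"
    using closed_compactin[OF compact_mult[OF L(1) I] _ closed] by blast
qed

end

section \<open>Transport of actions along homeomorphisms\<close>

lemma group_actionI:
  assumes "group G"
    and extensional: "\<And>g. g \<in> carrier G \<Longrightarrow> \<phi> g \<in> extensional E"
    and closed: "\<And>g x. g \<in> carrier G \<Longrightarrow> x \<in> E \<Longrightarrow> \<phi> g x \<in> E"
    and one: "\<And>x. x \<in> E \<Longrightarrow> \<phi> \<one>\<^bsub>G\<^esub> x = x"
    and mult: "\<And>g h x. g \<in> carrier G \<Longrightarrow> h \<in> carrier G \<Longrightarrow> x \<in> E \<Longrightarrow> \<phi> (g \<otimes>\<^bsub>G\<^esub> h) x = \<phi> g (\<phi> h x)"
  shows "group_action G E \<phi>"
proof -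
  interpret group G by (rule assms(1))
  have "bij_betw (\<phi> g) E E" if g: "g \<in> carrier G" for g
    by (rule bij_betw_byWitness[where f' = "\<phi> (inv\<^bsub>G\<^esub> g)"])
      (use g closed one mult[symmetric] in auto)
  then have Bij: "\<phi> g \<in> Bij E" if "g \<in> carrier G" for g
    using that extensional by (simp add: Bij_def)
  have "\<phi> \<in> hom G (BijGroup E)"
  proof (rule homI)
    show "\<phi> g \<in> carrier (BijGroup E)" if "g \<in> carrier G" for g
      using Bij[OF that] by (simp add: BijGroup_def)
    show "\<phi> (g \<otimes>\<^bsub>G\<^esub> h) = \<phi> g \<otimes>\<^bsub>BijGroup E\<^esub> \<phi> h" if "g \<in> carrier G" "h \<in> carrier G" for g h
    proof -
      have "\<phi> (g \<otimes>\<^bsub>G\<^esub> h) = compose E (\<phi> g) (\<phi> h)"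
        by (rule extensionalityI[of _ E]) (use that extensional mult in \<open>auto simp: compose_def\<close>)
      then show ?thesis using that Bij by (simp add: BijGroup_def)
    qed
  qed
  then show ?thesis
    by (simp add: group_action_def group_hom_def group_hom_axioms_def group_BijGroup \<open>group G\<close>)
qed

text \<open>
  The transported action is the conjugate of \<open>\<phi>\<close> by the homeomorphism, cut off outside \<open>topspace Y\<close>
  because elements of \<open>BijGroup\<close> are extensional.
\<close>
lemma transport_action:
  fixes X :: "'x topology" and Y :: "'y topology"
  assumes "group G" and homeo: "homeomorphic_maps X Y F F'"
    and closed: "\<And>g x. g \<in> carrier G \<Longrightarrow> x \<in> topspace X \<Longrightarrow> \<phi> g x \<in> topspace X"
    and one: "\<And>x. x \<in> topspace X \<Longrightarrow> \<phi> \<one>\<^bsub>G\<^esub> x = x"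
    and mult: "\<And>g h x. g \<in> carrier G \<Longrightarrow> h \<in> carrier G \<Longrightarrow> x \<in> topspace X \<Longrightarrow>
                 \<phi> (g \<otimes>\<^bsub>G\<^esub> h) x = \<phi> g (\<phi> h x)"
    and continuous: "continuous_action T X \<phi>"
    and free: "free_action G (topspace X) \<phi>"
    and mixing: "topologically_mixing G T X \<phi>"
  obtains \<psi> where "group_action G (topspace Y) \<psi>" "continuous_action T Y \<psi>"
    "free_action G (topspace Y) \<psi>" "topologically_mixing G T Y \<psi>"
proof -
  interpret group G by (rule assms(1))
  have F: "continuous_map X Y F" and F': "continuous_map Y X F'"
    and F'F: "\<And>x. x \<in> topspace X \<Longrightarrow> F' (F x) = x" and FF': "\<And>y. y \<in> topspace Y \<Longrightarrow> F (F' y) = y"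
    using homeo by (auto simp: homeomorphic_maps_def)
  have FY: "F x \<in> topspace Y" if "x \<in> topspace X" for x
    using continuous_map_funspace[OF F] that by blast
  have F'X: "F' y \<in> topspace X" if "y \<in> topspace Y" for y
    using continuous_map_funspace[OF F'] that by blast
  define \<psi> where "\<psi> g = (\<lambda>y\<in>topspace Y. F (\<phi> g (F' y)))" for g
  have \<psi>: "\<psi> g y = F (\<phi> g (F' y))" if "y \<in> topspace Y" for g y
    using that by (simp add: \<psi>_def)
  have "group_action G (topspace Y) \<psi>"
    by (rule group_actionI[OF \<open>group G\<close>]) (use closed one mult FF' F'F FY F'X in \<open>auto simp: \<psi>_def\<close>)
  moreover have "continuous_action T Y \<psi>"
  proof -
    have "continuous_map (prod_topology T Y) (prod_topology T X) (\<lambda>p. (fst p, F' (snd p)))"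
      using continuous_map_compose[OF continuous_map_snd F']
      by (auto simp: continuous_map_pairwise o_def intro: continuous_map_fst)
    from continuous_map_compose[OF continuous_map_compose[OF this continuous[unfolded continuous_action_def]] F]
    have "continuous_map (prod_topology T Y) Y (\<lambda>p. F (\<phi> (fst p) (F' (snd p))))"
      by (simp add: o_def)
    then show ?thesis
      unfolding continuous_action_def by (rule continuous_map_eq) (auto simp: \<psi>)
  qed
  moreover have "free_action G (topspace Y) \<psi>"
    unfolding free_action_def
  proof (intro ballI impI)
    fix g y assume g: "g \<in> carrier G" and y: "y \<in> topspace Y" and stab: "\<psi> g y = y"
    have "\<phi> g (F' y) = F' (\<psi> g y)" using closed[OF g F'X[OF y]] F'F y by (simp add: \<psi>)
    then show "g = \<one>\<^bsub>G\<^esub>" using free g F'X[OF y] stab unfolding free_action_def by metis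
  qed
  moreover have "topologically_mixing G T Y \<psi>"
    unfolding topologically_mixing_def
  proof (intro allI impI, elim conjE)
    fix U V assume U: "openin Y U" "U \<noteq> {}" and V: "openin Y V" "V \<noteq> {}"
    let ?P = "\<lambda>W. {x \<in> topspace X. F x \<in> W}"
    have sub: "U \<subseteq> topspace Y" "V \<subseteq> topspace Y" using U V openin_subset by auto
    have ne: "?P W \<noteq> {}" if W: "W \<subseteq> topspace Y" "W \<noteq> {}" for W
    proof -
      obtain y where "y \<in> W" using W(2) by blast
      then have "F' y \<in> ?P W" using W(1) F'X FF' by auto
      then show ?thesis by blast
    qed
    have "\<psi> g ` U \<inter> V \<noteq> {} \<longleftrightarrow> \<phi> g ` ?P U \<inter> ?P V \<noteq> {}" if g: "g \<in> carrier G" for g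
    proof
      assume "\<psi> g ` U \<inter> V \<noteq> {}"
      then obtain y where y: "y \<in> U" "\<psi> g y \<in> V" by blast
      then have "y \<in> topspace Y" using sub by blast
      then have "F' y \<in> ?P U" "\<phi> g (F' y) \<in> ?P V"
        using y closed[OF g] F'X FF' by (auto simp: \<psi>)
      then show "\<phi> g ` ?P U \<inter> ?P V \<noteq> {}" by blast
    next
      assume "\<phi> g ` ?P U \<inter> ?P V \<noteq> {}"
      then obtain x where x: "x \<in> topspace X" "F x \<in> U" "F (\<phi> g x) \<in> V" by blast
      then have "\<psi> g (F x) \<in> V" using FY F'F by (simp add: \<psi>)
      then show "\<psi> g ` U \<inter> V \<noteq> {}" using x(2) by blast
    qed
    then have "return_set G \<psi> U V = return_set G \<phi> (?P U) (?P V)"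
      unfolding return_set_def by blast
    moreover have "compactin T (carrier G - return_set G \<phi> (?P U) (?P V))"
      by (intro mixing[unfolded topologically_mixing_def, rule_format] conjI
          openin_continuous_map_preimage[OF F] U V ne sub)
    ultimately show "compactin T (carrier G - return_set G \<psi> U V)" by simp
  qed
  ultimately show thesis by (rule that)
qed

theorem proposition2p5:
  fixes G :: "('g, 'r) monoid_scheme" and T :: "'g topology"
  assumes "topological_group G T"
    and "Polish_topology T"
    and "locally_compact_space T"
    and "\<not> compact_space T"
  shows "\<exists>(X :: (nat \<Rightarrow> real) topology) \<phi>.
           topspace X \<noteq> {} \<and> Polish_topology X \<and>
           group_action G (topspace X) \<phi> \<and> continuous_action T X \<phi> \<and>
           free_action G (topspace X) \<phi> \<and> topologically_mixing G T X \<phi>"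
proof -
  have metrizable: "metrizable_space T"
    using assms(2) completely_metrizable_imp_metrizable_space by (auto simp: Polish_topology_def)
  interpret topological_group G T by (rule assms(1))
  interpret lcsc_group G T
  proof unfold_locales
    show "locally_compact_space T" by (rule assms(3))
    show "Hausdorff_space T" using metrizable by (rule metrizable_imp_Hausdorff_space)
    show "second_countable T"
      using metrizable assms(2) by (simp add: metrizable_separable_imp_second_countable Polish_topology_def)
  qed
  let ?X = "subtopology (compact_open T) free_maps"
  have tX: "topspace ?X = free_maps" by (auto simp: free_maps_def)
  have sub: "free_maps \<subseteq> cmaps T" by (auto simp: free_maps_def)
  obtain Y :: "(nat \<Rightarrow> real) topology" where Y: "Polish_topology Y" "?X homeomorphic_space Y"
    using Polish_topology_homeomorphic_nat_real[OF Polish_free_maps] by blast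
  then obtain F F' where homeo: "homeomorphic_maps ?X Y F F'" unfolding homeomorphic_space_def by blast
  obtain \<psi> where \<psi>: "group_action G (topspace Y) \<psi>" "continuous_action T Y \<psi>"
    "free_action G (topspace Y) \<psi>" "topologically_mixing G T Y \<psi>"
  proof (rule transport_action[OF is_group homeo])
    show "free_action G (topspace ?X) translate"
      unfolding tX by (auto simp: free_action_def free_maps_def)
  qed (use translate_in_free_maps translate_one translate_mult sub continuous_action_free_maps
         mixing_free_maps[OF assms(4)] in \<open>unfold tX, auto\<close>)
  have "(\<lambda>x\<in>topspace T. 0) \<in> cmaps T" by (rule cmaps_restrict) simp
  then have "free_maps \<noteq> {}" using dense_free_maps[OF assms(4)] by auto
  then have "topspace Y \<noteq> {}"
    using homeomorphic_empty_space[OF Y(2)] unfolding null_topspace_iff_trivial[symmetric] tX by simp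
  with Y(1) \<psi> show ?thesis by blast
qed

end
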